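(* Let $\Omega=\mathbb{R}$, let $f\colon\mathbb{R}\to\mathbb{R}_+$ be a positive convex function with $f(1)=0$, let $\hat f(u)=f(\frac{1}{u})$ be strictly convex in $u$, and let $\hat f^*(v)=\sup_{u\in\mathbb{R}}\{uv-\hat f(u)\}$ be the conjugate function of $\hat f$. Let $p,q\in\mathcal{P}(\Omega)$, and let $T$ be the monotone mapping function with $T_\#q=p$. Then $$\Psi_{\mathrm{opt}}(x)=\hat f'\Big(\frac{1}{\Phi_0''(x)+1}\Big),$$ where $$\Phi_0(x)=\int_0^xT(y)\,dy-\frac{|x|^2}{2}+c_0\qquad(c_0\in\mathbb{R}\ \text{a constant})$$ is the Kantorovich duality variable and $\Psi_{\mathrm{opt}}(x)=\hat f'\big(\frac{1}{T'(x)}\big)$ is the transport $f$-duality variable. In addition, the transport $f$-divergence is reformulated as $$\mathrm{D}_{\mathrm{T},f}(p\|q)=\int_\Omega\hat f'\Big(\frac{1}{\Phi_0''(x)+1}\Big)p(\Phi_0'(x)+x)\,dx-\int_\Omega\hat f^*\Big(\hat f'\Big(\frac{1}{\Phi_0''(x)+1}\Big)\Big)q(x)\,dx .$$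
   Context: $\mathcal{P}(\Omega)=\{p\in C^\infty(\Omega):\int_\Omega p(x)\,dx=1,\ p(x)>0\}$ is the space of smooth positive probability density functions on $\Omega$. For $p,q\in\mathcal{P}(\Omega)$, the monotone mapping function $T$ with $T_\#q=p$ (push-forward of $q$ to $p$) is $T(x)=F_p^{-1}(F_q(x))$, where $F_p,F_q$ are the cumulative distribution functions of $p,q$; it satisfies $p(T(x))\,T'(x)=q(x)$. Definition (transport $f$-divergence): $$\mathrm{D}_{\mathrm{T},f}(p\|q)=\int_\Omega f\Big(\frac{q(x)}{p(T(x))}\Big)q(x)\,dx .$$
   Formalization: f is taken convex and nonnegative on (0,∞) only, with f̂ strictly convex and differentiable there and +∞ for u≤0 in the conjugate; the reformulated divergence identity is asserted when both right-hand integrals exist in [-∞,∞] and their difference is not ∞−∞. *)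

theory Defs
  imports "HOL-Probability.Probability"
begin

definition smooth :: "(real \<Rightarrow> real) \<Rightarrow> bool" where
  "smooth g \<longleftrightarrow> (\<forall>n x. (deriv ^^ n) g differentiable at x)"

definition prob_densities :: "(real \<Rightarrow> real) set" where
  "prob_densities = {p. smooth p \<and> (\<forall>x. 0 < p x) \<and> has_bochner_integral lborel p 1}"

abbreviation law :: "(real \<Rightarrow> real) \<Rightarrow> real measure" where
  "law p \<equiv> density lborel (\<lambda>x. ennreal (p x))"

text \<open>For a positive density the cumulative distribution function is injective with range the open
  unit interval, so \<^term>\<open>inv\<close> is its genuine inverse at every value of another such function.\<close>

definition monotone_map :: "(real \<Rightarrow> real) \<Rightarrow> (real \<Rightarrow> real) \<Rightarrow> real \<Rightarrow> real" where
  "monotone_map p q x = inv (cdf (law p)) (cdf (law q) x)"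

text \<open>The integrand is nonnegative when \<open>f\<close> is, so the divergence always has a value in
  \<open>[0, \<infinity>]\<close>.\<close>

definition transport_f_div ::
    "(real \<Rightarrow> real) \<Rightarrow> (real \<Rightarrow> real) \<Rightarrow> (real \<Rightarrow> real) \<Rightarrow> ennreal" where
  "transport_f_div f p q = (\<integral>\<^sup>+x. ennreal (f (q x / p (monotone_map p q x)) * q x) \<partial>lborel)"

definition strictly_convex_on :: "real set \<Rightarrow> (real \<Rightarrow> real) \<Rightarrow> bool" where
  "strictly_convex_on S g \<longleftrightarrow> convex S \<and>
     (\<forall>x\<in>S. \<forall>y\<in>S. \<forall>t. x \<noteq> y \<longrightarrow> 0 < t \<longrightarrow> t < 1 \<longrightarrow>
        g ((1 - t) * x + t * y) < (1 - t) * g x + t * g y)"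

definition f_hat :: "(real \<Rightarrow> real) \<Rightarrow> real \<Rightarrow> real" where
  "f_hat f u = f (1 / u)"

text \<open>The generator \<open>f\<close> is only ever evaluated at density ratios, so its effective domain is
  \<open>(0, \<infinity>)\<close>. (A finite convex function on the whole line is bounded near 0, and then
  \<^term>\<open>f_hat f\<close> cannot be strictly convex on \<open>(0, \<infinity>)\<close> with its minimum at 1.)
  In the conjugate, whose supremum is over all real \<open>u\<close>, \<^term>\<open>f_hat f\<close> is therefore
  extended by \<open>\<infinity>\<close> outside that domain.\<close>

definition extend_pos :: "(real \<Rightarrow> real) \<Rightarrow> real \<Rightarrow> ereal" where
  "extend_pos g u = (if 0 < u then ereal (g u) else \<infinity>)"

definition conjugate :: "(real \<Rightarrow> ereal) \<Rightarrow> real \<Rightarrow> ereal" where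
  "conjugate g v = (SUP u. ereal (u * v) - g u)"

definition kantorovich_var :: "(real \<Rightarrow> real) \<Rightarrow> real \<Rightarrow> real \<Rightarrow> real" where
  "kantorovich_var T c\<^sub>0 x = (LBINT y=ereal 0..ereal x. T y) - \<bar>x\<bar>\<^sup>2 / 2 + c\<^sub>0"

definition transport_f_dual_var :: "(real \<Rightarrow> real) \<Rightarrow> (real \<Rightarrow> real) \<Rightarrow> real \<Rightarrow> real" where
  "transport_f_dual_var f T x = deriv (f_hat f) (1 / deriv T x)"

text \<open>Lebesgue integral of an extended real function, with values in \<open>[-\<infinity>, \<infinity>]\<close>, as the
  difference of the integrals of the positive and negative parts (\<^term>\<open>e2ennreal\<close> sends negative
  values to 0). It is meaningful when these are not both infinite.\<close>

definition ext_integral :: "'a measure \<Rightarrow> ('a \<Rightarrow> ereal) \<Rightarrow> ereal" where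
  "ext_integral M g =
     enn2ereal (\<integral>\<^sup>+x. e2ennreal (g x) \<partial>M) - enn2ereal (\<integral>\<^sup>+x. e2ennreal (- g x) \<partial>M)"

definition has_ext_integral :: "'a measure \<Rightarrow> ('a \<Rightarrow> ereal) \<Rightarrow> bool" where
  "has_ext_integral M g \<longleftrightarrow>
     (\<integral>\<^sup>+x. e2ennreal (g x) \<partial>M) < \<infinity> \<or> (\<integral>\<^sup>+x. e2ennreal (- g x) \<partial>M) < \<infinity>"

text \<open>\<open>a - b\<close> is not of the form \<open>\<infinity> - \<infinity>\<close> or \<open>(-\<infinity>) - (-\<infinity>)\<close>.\<close>

definition diff_defined :: "ereal \<Rightarrow> ereal \<Rightarrow> bool" where
  "diff_defined a b \<longleftrightarrow> \<not> (\<bar>a\<bar> = \<infinity> \<and> a = b)"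

lemma ext_integral_eq_integral:
  assumes "integrable M g"
  shows "has_ext_integral M (\<lambda>x. ereal (g x))"
    and "ext_integral M (\<lambda>x. ereal (g x)) = ereal (integral\<^sup>L M g)"
proof -
  obtain r s where rs: "0 \<le> r" "0 \<le> s"
    "(\<integral>\<^sup>+x. ennreal (g x) \<partial>M) = ennreal r" "(\<integral>\<^sup>+x. ennreal (- g x) \<partial>M) = ennreal s"
    "integral\<^sup>L M g = r - s"
    using integrableE[OF assms] by metis
  then show "has_ext_integral M (\<lambda>x. ereal (g x))"
    by (simp add: has_ext_integral_def)
  show "ext_integral M (\<lambda>x. ereal (g x)) = ereal (integral\<^sup>L M g)"
    using rs by (simp add: ext_integral_def)
qed

end

theory Submission
  imports Defs
begin

text \<open>A monotone \<open>T\<close> pushing \<open>q\<close> to \<open>p\<close> satisfies \<open>F\<^sub>p \<circ> T = F\<^sub>q\<close> at every point, so it is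
  differentiable with \<open>T' = q / (p \<circ> T)\<close>, and \<open>\<Phi>\<^sub>0'' + 1 = T'\<close>. At \<open>u = 1 / T'\<close> the equality case
  of the Fenchel-Young inequality, multiplied by \<open>q\<close>, expresses the integrand of the divergence as
  the difference of the integrands of the two dual terms.\<close>

section \<open>Distribution functions, the transport map and the Kantorovich variable\<close>

lemma prob_densityD:
  assumes "p \<in> prob_densities"
  shows prob_density_pos: "0 < p x"
    and prob_density_isCont: "isCont p x"
    and prob_density_integrable: "integrable lborel p"
    and prob_density_integral: "integral\<^sup>L lborel p = 1"
    and prob_density_measurable: "p \<in> borel_measurable borel"
proof -
  have "(deriv ^^ 0) p differentiable at x" for x
    using assms unfolding prob_densities_def smooth_def by blast
  then have *: "isCont p x" for x
    by (simp add: differentiable_imp_continuous_within)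
  then show "isCont p x" .
  show "p \<in> borel_measurable borel"
    by (intro borel_measurable_continuous_onI continuous_at_imp_continuous_on) (simp add: *)
qed (use assms in \<open>auto simp: prob_densities_def has_bochner_integral_iff\<close>)

lemma real_distribution_law:
  assumes "p \<in> prob_densities"
  shows "real_distribution (law p)"
proof -
  note [measurable] = prob_density_measurable[OF assms]
  have "(\<integral>\<^sup>+x. ennreal (p x) \<partial>lborel) = 1"
    using prob_density_integrable[OF assms] prob_density_integral[OF assms]
      prob_density_pos[OF assms]
    by (subst nn_integral_eq_integral) (auto intro: less_imp_le)
  then have "prob_space (law p)"
    by (intro prob_spaceI) (simp add: emeasure_density)
  then show ?thesis
    by (simp add: real_distribution_def real_distribution_axioms_def)
qed

lemma measure_law_Ioc:
  assumes p: "p \<in> prob_densities" and "a \<le> b"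
  shows "measure (law p) {a<..b} = (LBINT y=ereal a..ereal b. p y)"
proof -
  note [measurable] = prob_density_measurable[OF p]
  have int: "integrable lborel (\<lambda>x. indicator {a<..b} x *\<^sub>R p x)"
    by (intro integrable_mult_indicator prob_density_integrable[OF p]) simp
  have "emeasure (law p) {a<..b} = (\<integral>\<^sup>+x. ennreal (indicator {a<..b} x *\<^sub>R p x) \<partial>lborel)"
    by (subst emeasure_density) (auto intro!: nn_integral_cong simp: indicator_def)
  also have "\<dots> = ennreal (\<integral>x. indicator {a<..b} x *\<^sub>R p x \<partial>lborel)"
    using prob_density_pos[OF p]
    by (intro nn_integral_eq_integral int) (auto simp: indicator_def less_imp_le)
  finally have "measure (law p) {a<..b} = (\<integral>x. indicator {a<..b} x *\<^sub>R p x \<partial>lborel)"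
    using prob_density_pos[OF p] unfolding measure_def
    by (subst enn2real_ennreal[symmetric])
       (auto intro!: integral_nonneg_AE simp: indicator_def less_imp_le)
  then show ?thesis
    using assms(2) by (simp add: interval_integral_Ioc set_lebesgue_integral_def)
qed

lemma DERIV_interval_integral:
  fixes g :: "real \<Rightarrow> real"
  assumes "\<And>x. isCont g x"
  shows "((\<lambda>u. LBINT y=ereal c..ereal u. g y) has_real_derivative g x) (at x)"
proof -
  \<comment> \<open>The interval contains \<open>c\<close> and has \<open>x\<close> in its interior,
    so the derivative within it is the two-sided derivative.\<close>
  let ?a = "min c x - 1" and ?b = "max c x + 1"
  have "((\<lambda>u. LBINT y=ereal c..ereal u. g y) has_vector_derivative g x) (at x within {?a..?b})"
    by (rule interval_integral_FTC2)
       (auto intro: continuous_at_imp_continuous_on assms)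
  moreover have "at x within {?a..?b} = at x"
    by (rule at_within_interior) (auto simp: interior_atLeastAtMost_real)
  ultimately show ?thesis
    by (simp add: has_real_derivative_iff_has_vector_derivative)
qed

lemma DERIV_cdf_law:
  assumes p: "p \<in> prob_densities"
  shows "(cdf (law p) has_real_derivative p x) (at x)"
proof -
  interpret real_distribution "law p" by (rule real_distribution_law[OF p])
  \<comment> \<open>Starting at \<open>x - 1\<close> makes the increment of the distribution
    function an integral over a bounded interval, and leaves an open neighbourhood of
    \<open>x\<close> on which the two functions agree.\<close>
  let ?F = "\<lambda>u. cdf (law p) (x - 1) + (LBINT y=ereal (x - 1)..ereal u. p y)"
  have "(?F has_real_derivative 0 + p x) (at x)"
    by (intro DERIV_add DERIV_const DERIV_interval_integral prob_density_isCont p)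
  moreover have "?F u = cdf (law p) u" if "u \<in> {x - 1<..}" for u
    using that cdf_diff_eq[of "x - 1" u] measure_law_Ioc[OF p, of "x - 1" u] by simp
  ultimately show ?thesis
    using has_field_derivative_transform_within_open[of ?F "p x" x "{x - 1<..}" "cdf (law p)"]
    by simp
qed

lemma strict_mono_cdf_law:
  assumes "p \<in> prob_densities"
  shows "strict_mono (cdf (law p))"
proof (rule strict_monoI)
  fix x y :: real assume "x < y"
  then show "cdf (law p) x < cdf (law p) y"
    by (rule DERIV_pos_imp_increasing) (blast intro: DERIV_cdf_law prob_density_pos assms)
qed

text \<open>Monotonicity gives \<open>{..x} \<subseteq> {y. T y \<le> T x}\<close> and \<open>{y. T y < T x} \<subseteq> {..x}\<close>; the laws have no
  atoms.\<close>

lemma cdf_mono_transport: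
  assumes p: "p \<in> prob_densities" and q: "q \<in> prob_densities"
    and T: "mono T" and distr: "distr (law q) borel T = law p"
  shows "cdf (law p) (T x) = cdf (law q) x"
proof -
  interpret P: real_distribution "law p" by (rule real_distribution_law[OF p])
  interpret Q: real_distribution "law q" by (rule real_distribution_law[OF q])
  have [measurable]: "T \<in> borel_measurable borel"
    by (rule borel_measurable_mono[OF T])
  have meas: "measure (law p) A = measure (law q) (T -` A)" if "A \<in> sets borel" for A
    using that unfolding distr[symmetric] by (subst measure_distr) auto
  have vim: "T -` A \<in> sets borel" if "A \<in> sets borel" for A
    using measurable_sets_borel[OF \<open>T \<in> borel_measurable borel\<close> that] by simp
  have "cdf (law q) x \<le> measure (law q) (T -` {..T x})"
    unfolding cdf_def by (rule Q.finite_measure_mono) (auto intro: monoD[OF T] vim)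
  then have 1: "cdf (law q) x \<le> cdf (law p) (T x)"
    by (simp add: cdf_def meas)
  have "isCont (cdf (law p)) (T x)"
    by (rule DERIV_isCont[OF DERIV_cdf_law[OF p]])
  then have "measure (law p) {T x} = 0"
    by (simp add: P.isCont_cdf)
  moreover have "{..T x} = {..<T x} \<union> {T x}" by auto
  then have "measure (law p) {..T x} = measure (law p) {..<T x} + measure (law p) {T x}"
    by (simp only:) (rule P.finite_measure_Union, auto)
  ultimately have "cdf (law p) (T x) = measure (law q) (T -` {..<T x})"
    by (simp add: cdf_def meas)
  also have "\<dots> \<le> cdf (law q) x"
    unfolding cdf_def
    by (rule Q.finite_measure_mono) (auto elim!: mono_strict_invE[OF T])
  finally show ?thesis using 1 by simp
qed

text \<open>Since \<open>cdf (law p)\<close> is injective, the identity of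
  \<open>cdf_mono_transport\<close> writes \<open>T\<close> as its inverse after
  \<open>cdf (law q)\<close>, so \<open>T\<close> inherits differentiability from the two
  distribution functions.\<close>

lemma DERIV_mono_transport:
  assumes p: "p \<in> prob_densities" and q: "q \<in> prob_densities"
    and "mono T" and "distr (law q) borel T = law p"
  shows "(T has_real_derivative q x / p (T x)) (at x)"
proof -
  let ?G = "inv (cdf (law p))"
  have inv: "?G (cdf (law p) y) = y" for y
    by (intro inv_f_f strict_mono_imp_inj_on strict_mono_cdf_law p)
  have T: "T = (\<lambda>y. ?G (cdf (law q) y))"
    using inv by (simp add: cdf_mono_transport[OF assms, symmetric])
  \<comment> \<open>This form of the inverse function theorem takes a continuous function with a
    left inverse and an invertible derivative at the single point \<open>T x\<close>; that
    derivative is nonzero because \<open>p\<close> is positive.\<close>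
  have "(?G has_derivative (*) (inverse (p (T x)))) (at (cdf (law p) (T x)))"
  proof (rule has_derivative_inverse_strong[where S = UNIV and f = "cdf (law p)" and x = "T x"])
    show "continuous_on UNIV (cdf (law p))"
      by (intro continuous_at_imp_continuous_on ballI DERIV_isCont[OF DERIV_cdf_law[OF p]])
    show "(cdf (law p) has_derivative (*) (p (T x))) (at (T x))"
      using DERIV_cdf_law[OF p] by (simp add: has_field_derivative_def)
    show "(*) (p (T x)) \<circ> (*) (inverse (p (T x))) = id"
      using prob_density_pos[OF p, of "T x"] by (simp add: fun_eq_iff)
  qed (use inv in auto)
  then have "(?G has_real_derivative inverse (p (T x))) (at (cdf (law q) x))"
    by (simp add: cdf_mono_transport[OF assms] has_field_derivative_def)
  from DERIV_chain2[OF this DERIV_cdf_law[OF q]] show ?thesis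
    by (subst T) (simp add: field_simps)
qed

text \<open>An equation between functions, so that it can be rewritten under the second
  \<open>deriv\<close>.\<close>

lemma deriv_kantorovich_var:
  assumes "\<And>x. isCont T x"
  shows "deriv (kantorovich_var T c) = (\<lambda>x. T x - x)"
proof
  fix x
  have "(kantorovich_var T c has_real_derivative T x - x) (at x)"
    unfolding kantorovich_var_def power2_abs
    by (rule derivative_eq_intros DERIV_interval_integral assms refl | simp)+
  then show "deriv (kantorovich_var T c) x = T x - x"
    by (rule DERIV_imp_deriv)
qed

section \<open>Tangents, conjugates and derivatives of convex functions\<close>

lemma strictly_convex_on_imp_convex_on:
  assumes "strictly_convex_on S g"
  shows "convex_on S g"
proof (intro convex_onI)
  fix t x y :: real assume *: "0 < t" "t < 1" "x \<in> S" "y \<in> S"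
  show "g ((1 - t) *\<^sub>R x + t *\<^sub>R y) \<le> (1 - t) * g x + t * g y"
  proof (cases "x = y")
    case True
    then show ?thesis by (simp flip: distrib_right scaleR_left_distrib)
  next
    case False
    with assms * show ?thesis
      by (simp add: strictly_convex_on_def less_imp_le)
  qed
qed (use assms in \<open>simp add: strictly_convex_on_def\<close>)

text \<open>The tangent inequality serves twice: it identifies the maximiser in the conjugate, and
  it makes the derivative monotone.\<close>

lemma convex_on_above_deriv:
  fixes g :: "real \<Rightarrow> real"
  assumes "convex_on {0<..} g" and "g differentiable at u" and "0 < u" and "0 < y"
  shows "deriv g u * (y - u) \<le> g y - g u"
proof -
  have "(g has_real_derivative deriv g u) (at u within {0<..})"
    using assms(2) by (simp add: DERIV_deriv_iff_real_differentiable has_field_derivative_at_within)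
  then show ?thesis
    using assms by (intro convex_on_imp_above_tangent[of "{0<..}"]) (auto simp: interior_open)
qed

text \<open>Equality case of Fenchel-Young: the tangent inequality at \<open>u\<close> bounds the
  term of every \<open>y > 0\<close>, any other \<open>y\<close> contributes -\<infinity>, and
  \<open>u\<close> itself attains the bound.\<close>

lemma conjugate_extend_pos_deriv:
  assumes "convex_on {0<..} g" and "g differentiable at u" and u: "0 < u"
  shows "conjugate (extend_pos g) (deriv g u) = ereal (deriv g u * u - g u)"
  unfolding conjugate_def
proof (rule antisym[OF SUP_least])
  fix y
  show "ereal (y * deriv g u) - extend_pos g y \<le> ereal (deriv g u * u - g u)"
    using convex_on_above_deriv[OF assms, of y] by (auto simp: extend_pos_def algebra_simps)
  show "ereal (deriv g u * u - g u) \<le> (SUP y. ereal (y * deriv g u) - extend_pos g y)"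
    by (rule SUP_upper2[of u]) (use u in \<open>auto simp: extend_pos_def mult.commute\<close>)
qed

text \<open>The derivative of a convex function increases, and monotone functions are Borel.
  Composition with \<open>exp\<close> moves this from the half-line to the whole line, and
  \<open>ln\<close> undoes it along the positive \<open>h\<close>.\<close>

lemma borel_measurable_deriv_convex:
  assumes g: "convex_on {0<..} g" and diff: "\<And>u. 0 < u \<Longrightarrow> g differentiable at u"
    and [measurable]: "h \<in> borel_measurable M" and h: "\<And>x. 0 < h x"
  shows "(\<lambda>x. deriv g (h x)) \<in> borel_measurable M"
proof -
  have "mono (\<lambda>t. deriv g (exp t))"
  proof (rule monoI)
    fix s t :: real assume st: "s \<le> t"
    \<comment> \<open>Sum of two tangent inequalities, each based at one of the points and evaluated
      at the other; the values of \<open>g\<close> cancel.\<close>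
    have "deriv g (exp s) * (exp t - exp s) + deriv g (exp t) * (exp s - exp t) \<le> 0"
      using convex_on_above_deriv[OF g diff, of "exp s" "exp t"]
        convex_on_above_deriv[OF g diff, of "exp t" "exp s"] by simp
    then have "0 \<le> (deriv g (exp t) - deriv g (exp s)) * (exp t - exp s)"
      by (simp add: algebra_simps)
    with st show "deriv g (exp s) \<le> deriv g (exp t)"
      by (cases "s = t") (auto simp: zero_le_mult_iff)
  qed
  then have [measurable]: "(\<lambda>t. deriv g (exp t)) \<in> borel_measurable borel"
    by (rule borel_measurable_mono)
  have "(\<lambda>x. deriv g (exp (ln (h x)))) \<in> borel_measurable M"
    by measurable
  then show ?thesis using h by simp
qed

section \<open>Integration of the pointwise identity\<close>

text \<open>The dual integrals may be infinite, so linearity is replaced by an identity between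
  nonnegative integrals, from which \<open>an\<close> and \<open>bp\<close> are cancelled. These two
  are finite because neither integral nor their difference is of indeterminate form.\<close>

lemma enn2ereal_nn_integral_diff:
  fixes a b :: "'a \<Rightarrow> real"
  assumes [measurable]: "a \<in> borel_measurable M" "b \<in> borel_measurable M"
    and le: "\<And>x. b x \<le> a x"
    and "has_ext_integral M (\<lambda>x. ereal (a x))" "has_ext_integral M (\<lambda>x. ereal (b x))"
    and "diff_defined (ext_integral M (\<lambda>x. ereal (a x))) (ext_integral M (\<lambda>x. ereal (b x)))"
  shows "enn2ereal (\<integral>\<^sup>+x. ennreal (a x - b x) \<partial>M) =
    ext_integral M (\<lambda>x. ereal (a x)) - ext_integral M (\<lambda>x. ereal (b x))"
proof -
  define ap where "ap = (\<integral>\<^sup>+x. ennreal (a x) \<partial>M)"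
  define an where "an = (\<integral>\<^sup>+x. ennreal (- a x) \<partial>M)"
  define bp where "bp = (\<integral>\<^sup>+x. ennreal (b x) \<partial>M)"
  define bn where "bn = (\<integral>\<^sup>+x. ennreal (- b x) \<partial>M)"
  define c where "c = (\<integral>\<^sup>+x. ennreal (a x - b x) \<partial>M)"
  have 1: "bp \<le> ap" "an \<le> bn"
    unfolding ap_def an_def bp_def bn_def
    by (auto intro!: nn_integral_mono ennreal_leI simp: le)
  \<comment> \<open>Positive and negative parts are arranged so that only sums of nonnegative terms
    remain; these integrate termwise even when infinite.\<close>
  have "ennreal (a x) + ennreal (- b x) = ennreal (a x - b x) + (ennreal (- a x) + ennreal (b x))"
    for x
    using le[of x]
    by (cases "0 \<le> a x"; cases "0 \<le> b x") (auto simp: ennreal_neg simp flip: ennreal_plus)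
  then have 2: "ap + bn = c + (an + bp)"
    unfolding ap_def an_def bp_def bn_def c_def by (simp flip: nn_integral_add)
  have ext: "ext_integral M (\<lambda>x. ereal (a x)) = enn2ereal ap - enn2ereal an"
    "ext_integral M (\<lambda>x. ereal (b x)) = enn2ereal bp - enn2ereal bn"
    by (simp_all add: ext_integral_def ap_def an_def bp_def bn_def)
  have 3: "ap < \<infinity> \<or> an < \<infinity>" "bp < \<infinity> \<or> bn < \<infinity>"
    "diff_defined (enn2ereal ap - enn2ereal an) (enn2ereal bp - enn2ereal bn)"
    using assms(4-6) unfolding ext
    by (simp_all add: has_ext_integral_def ap_def an_def bp_def bn_def)
  \<comment> \<open>Otherwise both extended integrals would be -\<infinity>.\<close>
  have "an \<noteq> \<infinity>"
  proof
    assume "an = \<infinity>"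
    with 1 3(1) have "bn = \<infinity>" "ap < \<infinity>" "bp < \<infinity>"
      by (auto simp: top_unique)
    with \<open>an = \<infinity>\<close> 3(3) show False
      by (cases ap; cases bp) (auto simp: diff_defined_def)
  qed
  \<comment> \<open>Otherwise both would be \<infinity>.\<close>
  moreover have "bp \<noteq> \<infinity>"
  proof
    assume "bp = \<infinity>"
    with 1 3(2) have "ap = \<infinity>" "bn < \<infinity>" "an < \<infinity>"
      by (auto simp: top_unique le_less_trans)
    with \<open>bp = \<infinity>\<close> 3(3) show False
      by (cases an; cases bn) (auto simp: diff_defined_def)
  qed
  ultimately obtain r s where "0 \<le> r" "0 \<le> s" "an = ennreal r" "bp = ennreal s"
    by (metis ennreal_cases infinity_ennreal_def)
  \<comment> \<open>With \<open>an\<close> and \<open>bp\<close> real, \<open>ap\<close> or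
    \<open>bn\<close> may still be infinite; then both sides are \<infinity>.\<close>
  with 2 3 have "enn2ereal c = (enn2ereal ap - enn2ereal an) - (enn2ereal bp - enn2ereal bn)"
    by (cases ap; cases bn; cases c)
       (auto simp: diff_defined_def simp flip: ennreal_plus)
  then show ?thesis by (simp add: ext c_def)
qed

theorem mainTheorem4:
  fixes f p q T :: "real \<Rightarrow> real" and c\<^sub>0 :: real
  assumes "convex_on {0<..} f" and "\<forall>u>0. 0 \<le> f u" and "f 1 = 0"
    and "strictly_convex_on {0<..} (f_hat f)"
    and "\<forall>u>0. f_hat f differentiable at u"
    and "p \<in> prob_densities" and "q \<in> prob_densities"
    and "mono T" and "distr (law q) borel T = law p"
  shows "let \<Phi>\<^sub>0 = kantorovich_var T c\<^sub>0;
             \<Psi> = (\<lambda>x. deriv (f_hat f) (1 / (deriv (deriv \<Phi>\<^sub>0) x + 1)));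
             I = ext_integral lborel (\<lambda>x. ereal (\<Psi> x * p (deriv \<Phi>\<^sub>0 x + x)));
             J = ext_integral lborel (\<lambda>x. conjugate (extend_pos (f_hat f)) (\<Psi> x) * ereal (q x))
         in (\<forall>x. transport_f_dual_var f T x = \<Psi> x) \<and>
            (has_ext_integral lborel (\<lambda>x. ereal (\<Psi> x * p (deriv \<Phi>\<^sub>0 x + x))) \<and>
             has_ext_integral lborel
               (\<lambda>x. conjugate (extend_pos (f_hat f)) (\<Psi> x) * ereal (q x)) \<and>
             diff_defined I J \<longrightarrow>
               enn2ereal (transport_f_div f p q) = I - J)"
proof -
  note p = assms(6) and q = assms(7) and transport = assms(6-9)
  let ?g = "f_hat f"
  have convex: "convex_on {0<..} ?g"
    by (rule strictly_convex_on_imp_convex_on) fact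
  have diff: "?g differentiable at u" if "0 < u" for u
    using assms(5) that by blast
  have [measurable]: "p \<in> borel_measurable borel" "q \<in> borel_measurable borel"
      "T \<in> borel_measurable borel"
    by (rule prob_density_measurable p q borel_measurable_mono assms(8))+
  note pos = prob_density_pos[OF p] prob_density_pos[OF q]
  have DT: "(T has_real_derivative q x / p (T x)) (at x)" for x
    by (rule DERIV_mono_transport[OF transport])
  then have dT: "deriv T x = q x / p (T x)" for x
    by (rule DERIV_imp_deriv)
  have d\<Phi>: "deriv (kantorovich_var T c\<^sub>0) = (\<lambda>x. T x - x)"
    by (rule deriv_kantorovich_var) (rule DERIV_isCont[OF DT])
  have dd\<Phi>: "deriv (\<lambda>x. T x - x) x + 1 = q x / p (T x)" for x
    using DERIV_imp_deriv[OF DERIV_diff[OF DT DERIV_ident], of x] by simp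
  \<comment> \<open>\<open>u\<close> is 1 / T', the point where the supremum in the conjugate is
    attained; \<open>\<psi>\<close> is the dual variable, and \<open>b\<close> the second dual
    integrand with the conjugate in its closed, real-valued form.\<close>
  define u where "u x = p (T x) / q x" for x
  define \<psi> where "\<psi> x = deriv ?g (u x)" for x
  define b where "b x = (\<psi> x * u x - ?g (u x)) * q x" for x
  have u_pos: "0 < u x" for x
    using pos by (simp add: u_def)
  have \<psi>: "deriv ?g (1 / (q x / p (T x))) = \<psi> x" for x
    by (simp add: \<psi>_def u_def)
  have conj: "conjugate (extend_pos ?g) (\<psi> x) * ereal (q x) = ereal (b x)" for x
    unfolding \<psi>_def b_def using conjugate_extend_pos_deriv[OF convex diff u_pos] u_pos by simp
  have [measurable]: "u \<in> borel_measurable borel"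
    unfolding u_def by measurable
  have [measurable]: "\<psi> \<in> borel_measurable borel"
    unfolding \<psi>_def by (rule borel_measurable_deriv_convex[OF convex diff]) (simp_all add: u_pos)
  \<comment> \<open>Continuity is known on the half-line only, so measurability again passes through
    \<open>exp\<close> and \<open>ln\<close>.\<close>
  have "continuous_on {0<..} ?g"
    by (intro continuous_at_imp_continuous_on ballI differentiable_imp_continuous_within diff) simp
  then have "continuous_on UNIV (\<lambda>t. ?g (exp t))"
    by (rule continuous_on_compose2) (auto intro: continuous_on_exp continuous_on_id)
  then have "(\<lambda>x. ?g (exp (ln (u x)))) \<in> borel_measurable borel"
    by (rule borel_measurable_continuous_on) simp
  then have [measurable]: "(\<lambda>x. ?g (u x)) \<in> borel_measurable borel"
    by (simp add: u_pos)
  have b_meas: "b \<in> borel_measurable borel"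
    unfolding b_def by measurable
  \<comment> \<open>Uses \<open>u x * q x = p (T x)\<close> and
    \<open>f_hat f (u x) = f (q x / p (T x))\<close>.\<close>
  have integrand: "f (q x / p (T x)) * q x = \<psi> x * p (T x) - b x" for x
    using pos[of x] unfolding b_def by (simp add: u_def f_hat_def algebra_simps)
  \<comment> \<open>Nonnegativity of \<open>f\<close> becomes the pointwise order of the two dual
    integrands that the integral lemma asks for.\<close>
  have "0 \<le> f (q x / p (T x)) * q x" for x
    using assms(2) pos by (simp add: less_imp_le)
  then have b_le: "b x \<le> \<psi> x * p (T x)" for x
    using integrand[of x] by (smt (verit))
  \<comment> \<open>The inverse is taken at a value that \<open>cdf (law p)\<close> attains at
    \<open>T x\<close>, so injectivity recovers \<open>T x\<close>.\<close>
  have "monotone_map p q x = T x" for x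
    unfolding monotone_map_def cdf_mono_transport[OF transport, symmetric]
    by (intro inv_f_f strict_mono_imp_inj_on strict_mono_cdf_law p)
  then have "transport_f_div f p q = (\<integral>\<^sup>+x. ennreal (\<psi> x * p (T x) - b x) \<partial>lborel)"
    by (simp add: transport_f_div_def integrand)
  then show ?thesis
    unfolding Let_def transport_f_dual_var_def d\<Phi> dd\<Phi> dT \<psi> conj
    using enn2ereal_nn_integral_diff[of "\<lambda>x. \<psi> x * p (T x)" lborel b] b_meas b_le by simp
qed

end
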